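(* Let $b,c$ be positive integers with $\gcd(b,c)=1$ and $b+c=4^l$ for a positive integer $l$. Then for all nonnegative integers $m,n$ with $2m+n=\frac{4^l-1}{3}$ there is a perfect coloring of $D(m,n)$ with quotient matrix $\begin{pmatrix} c-1 & b\\ c & b-1\end{pmatrix}$.
   Context: The Shrikhande graph is the Cayley graph on $\mathbb{Z}_4^2$ with connection set $\{01,03,10,30,11,33\}$. For nonnegative integers $m,n$, $D(m,n)$ is the Cartesian product of $m$ copies of the Shrikhande graph and $n$ copies of $K_4$ (vertex set $(\mathbb{Z}_4^2)^m\times\mathbb{Z}_4^n$; adjacent iff differing in exactly one coordinate by an adjacency of that factor). A $2$-coloring (surjective map onto colors $\{1,2\}$) is perfect with quotient matrix $(s_{ij})$ if every vertex of color $i$ has exactly $s_{ij}$ neighbours of color $j$. *)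

theory Defs
  imports "HOL-Analysis.Cartesian_Space" "Graph_Theory.Graph_Theory"
begin

(* The numeral types 2 and 4 carry the ring structures Z/2 and Z/4; pairs are added
   componentwise, so the type 4 \<times> 4 is the group Z_4^2.  Simple graphs are represented
   as symmetric loop-free pair digraphs. *)

definition cayley_graph :: "'a::ab_group_add set \<Rightarrow> 'a pair_pre_digraph" where
  "cayley_graph S = \<lparr> pverts = UNIV, parcs = {(u, v). v - u \<in> S} \<rparr>"

definition shrikhande :: "(4 \<times> 4) pair_pre_digraph" where
  "shrikhande = cayley_graph {(0,1), (0,3), (1,0), (3,0), (1,1), (3,3)}"

definition K4 :: "4 pair_pre_digraph" where
  "K4 = \<lparr> pverts = UNIV, parcs = {(u, v). u \<noteq> v} \<rparr>"

definition cart_prod :: "'a pair_pre_digraph \<Rightarrow> 'b pair_pre_digraph \<Rightarrow> ('a \<times> 'b) pair_pre_digraph" where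
  "cart_prod G H =
     \<lparr> pverts = pverts G \<times> pverts H,
       parcs = {((u, x), (v, y)).
         (u, v) \<in> parcs G \<and> x = y \<and> x \<in> pverts H \<or>
         u = v \<and> u \<in> pverts G \<and> (x, y) \<in> parcs H} \<rparr>"

(* The Cartesian product of k copies of G; vertices are the lists of length k over the
   vertices of G. *)
definition cart_power :: "nat \<Rightarrow> 'a pair_pre_digraph \<Rightarrow> 'a list pair_pre_digraph" where
  "cart_power k G =
     \<lparr> pverts = {xs. length xs = k \<and> set xs \<subseteq> pverts G},
       parcs = {(xs, ys). length xs = k \<and> set xs \<subseteq> pverts G \<and>
         (\<exists>i<k. \<exists>v. (xs ! i, v) \<in> parcs G \<and> ys = xs[i := v])} \<rparr>"

definition doob_graph :: "nat \<Rightarrow> nat \<Rightarrow> ((4 \<times> 4) list \<times> 4 list) pair_pre_digraph" where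
  "doob_graph m n = cart_prod (cart_power m shrikhande) (cart_power n K4)"

(* The colours are the elements of the finite type 'c; for the type 2 these are 1 and 2
   (where 2 = 0), and the entries of a matrix S :: nat^2^2 are S $ 1 $ 1, ..., S $ 2 $ 2. *)
definition perfect_coloring :: "'a pair_pre_digraph \<Rightarrow> ('a \<Rightarrow> 'c::finite) \<Rightarrow> nat^'c^'c \<Rightarrow> bool" where
  "perfect_coloring G f S \<longleftrightarrow>
     f ` pverts G = UNIV \<and>
     (\<forall>v \<in> pverts G. \<forall>j. card {w \<in> pverts G. (v, w) \<in> parcs G \<and> f w = j} = S $ f v $ j)"

lemma pair_graphI:
  assumes "finite (pverts G)" "parcs G \<subseteq> pverts G \<times> pverts G"
    and "\<And>u v. (u, v) \<in> parcs G \<Longrightarrow> (v, u) \<in> parcs G \<and> u \<noteq> v"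
  shows "pair_graph G"
proof unfold_locales
  show "finite (parcs G)"
    using assms(1,2) by (meson finite_SigmaI finite_subset)
  show "symmetric (with_proj G)"
    using assms(3) by (auto simp: symmetric_def intro!: symI)
qed (use assms(1,2) in \<open>auto dest: assms(3)\<close>)

lemma pair_graphD:
  assumes "pair_graph G"
  shows "finite (pverts G)" "(u, v) \<in> parcs G \<Longrightarrow> u \<in> pverts G \<and> v \<in> pverts G"
    and "(u, v) \<in> parcs G \<Longrightarrow> (v, u) \<in> parcs G \<and> u \<noteq> v"
proof -
  interpret pair_graph G by fact
  show "finite (pverts G)" by (rule pair_finite_verts)
  show "(u, v) \<in> parcs G \<Longrightarrow> u \<in> pverts G \<and> v \<in> pverts G"
    using wellformed' by blast
  show "(u, v) \<in> parcs G \<Longrightarrow> (v, u) \<in> parcs G \<and> u \<noteq> v"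
    using pair_no_loops pair_sym_arcs by (force simp: symmetric_def dest: symD)
qed

lemma pair_graph_shrikhande: "pair_graph shrikhande"
proof (rule pair_graphI)
  fix u v assume "(u, v) \<in> parcs shrikhande"
  then have *: "v - u \<in> {(0,1), (0,3), (1,0), (3,0), (1,1), (3,3)}"
    by (simp add: shrikhande_def cayley_graph_def)
  have "- (v - u) \<in> {(0,1), (0,3), (1,0), (3,0), (1,1), (3,3)}"
    using * by (elim insertE emptyE) simp_all
  then have "u - v \<in> {(0,1), (0,3), (1,0), (3,0), (1,1), (3,3)}"
    by (simp only: minus_diff_eq)
  moreover have "u \<noteq> v" using * by (auto simp: zero_prod_def)
  ultimately show "(v, u) \<in> parcs shrikhande \<and> u \<noteq> v"
    by (simp add: shrikhande_def cayley_graph_def)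
qed (auto simp: shrikhande_def cayley_graph_def)

lemma degree_cayley_graph: "card {v. (u, v) \<in> parcs (cayley_graph S)} = card S"
proof -
  have "{v. v - u \<in> S} = (\<lambda>s. s + u) ` S"
  proof (intro equalityI subsetI)
    fix v assume "v \<in> {v. v - u \<in> S}"
    then show "v \<in> (\<lambda>s. s + u) ` S"
      by (intro image_eqI[where x = "v - u"]) simp_all
  qed auto
  then show ?thesis
    by (simp add: cayley_graph_def card_image inj_on_def)
qed

lemma degree_shrikhande: "card {v. (u, v) \<in> parcs shrikhande} = 6"
  by (simp add: shrikhande_def degree_cayley_graph)

lemma pair_graph_K4: "pair_graph K4"
  by (rule pair_graphI) (auto simp: K4_def)

lemma complete_K4: "complete_digraph 4 (with_proj K4)"
  using pair_graph_K4 unfolding complete_digraph_pair_def by (auto simp: K4_def)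

lemma pair_graph_cart_prod:
  assumes "pair_graph G" "pair_graph H"
  shows "pair_graph (cart_prod G H)"
proof (rule pair_graphI)
  note G = pair_graphD[OF assms(1)] and H = pair_graphD[OF assms(2)]
  show "finite (pverts (cart_prod G H))"
    using G(1) H(1) by (simp add: cart_prod_def)
  show "parcs (cart_prod G H) \<subseteq> pverts (cart_prod G H) \<times> pverts (cart_prod G H)"
    using G(2) H(2) by (auto simp: cart_prod_def)
  show "(v, u) \<in> parcs (cart_prod G H) \<and> u \<noteq> v" if "(u, v) \<in> parcs (cart_prod G H)" for u v
    using that G(3) H(3) unfolding cart_prod_def by (cases u; cases v) (simp, blast)
qed

lemma pair_graph_cart_power:
  assumes "pair_graph G"
  shows "pair_graph (cart_power k G)"
proof (rule pair_graphI)
  note G = pair_graphD[OF assms]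
  have "pverts (cart_power k G) = {xs. set xs \<subseteq> pverts G \<and> length xs = k}"
    by (auto simp: cart_power_def)
  then show "finite (pverts (cart_power k G))"
    using finite_lists_length_eq[OF G(1)] by simp
  show sub: "parcs (cart_power k G) \<subseteq> pverts (cart_power k G) \<times> pverts (cart_power k G)"
    using G(2) by (auto simp: cart_power_def dest!: set_update_subset_insert[THEN subsetD])
  fix xs ys assume arc: "(xs, ys) \<in> parcs (cart_power k G)"
  then obtain i v where i: "length xs = k" "i < k" "(xs ! i, v) \<in> parcs G" "ys = xs[i := v]"
    by (auto simp: cart_power_def)
  have "ys \<in> pverts (cart_power k G)" using arc sub by blast
  moreover have "(ys ! i, xs ! i) \<in> parcs G" "xs = ys[i := xs ! i]"
    using i G(3) by auto
  ultimately have "(ys, xs) \<in> parcs (cart_power k G)"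
    using i(2) unfolding cart_power_def by auto
  moreover have "xs ! i \<noteq> ys ! i" using i G(3) by auto
  ultimately show "(ys, xs) \<in> parcs (cart_power k G) \<and> xs \<noteq> ys" by auto
qed

lemma pair_graph_doob_graph: "pair_graph (doob_graph m n)"
  unfolding doob_graph_def
  by (intro pair_graph_cart_prod pair_graph_cart_power pair_graph_shrikhande pair_graph_K4)

end

theory Submission
  imports Defs
begin

text \<open>
  Call a coloring with \<open>4\<^sup>l\<close> colors rainbow if every closed neighbourhood carries each color exactly
  once, i.e. if the color classes partition the graph into 1-perfect codes; merging \<open>c\<close> of the
  classes into one color gives the required matrix. Rainbow colorings are built by induction on
  \<open>l\<close>. In the step from \<open>l\<close> to \<open>l + 1\<close>, with \<open>k = (4\<^sup>l - 1) / 3\<close> and one copy of \<open>K4\<close> set aside, the remaining factors of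
  \<open>D(m,n)\<close> are grouped into \<open>k\<close> chunks \<open>D(2,0)\<close>, \<open>D(1,2)\<close> or \<open>D(0,4)\<close>. Each chunk has a map
  \<open>(a, b)\<close> to \<open>4 \<times> 4\<close> whose restriction to the 12 neighbours of a vertex \<open>v\<close> is a bijection onto the
  pairs with first component different from \<open>a v\<close>. Then the color of a vertex is \<open>h (a\<^sub>1, \<dots>, a\<^sub>k)\<close>
  together with the sum of the \<open>b\<^sub>i\<close> and the coordinate set aside, where \<open>h\<close> is a rainbow coloring
  of \<open>D(0,k)\<close>. The chunk maps come from homomorphisms to groups of order 16 in which the images of
  the connection sets partition the complement of a subgroup \<open>P\<close> of order 4: \<open>a\<close> is the coset
  of \<open>P\<close> and \<open>b\<close> the position in the coset.
\<close>

subsection \<open>Neighbourhoods in Doob graphs\<close>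

definition nbrs :: "'a pair_pre_digraph \<Rightarrow> 'a \<Rightarrow> 'a set" where
  "nbrs G v = {w. (v, w) \<in> parcs G}"

lemma nbrs_shrikhande:
  "nbrs shrikhande x = (+) x ` {(0,1), (0,3), (1,0), (3,0), (1,1), (3,3)}"
proof -
  have "nbrs shrikhande x = {y. y - x \<in> {(0,1), (0,3), (1,0), (3,0), (1,1), (3,3)}}"
    by (simp add: nbrs_def shrikhande_def cayley_graph_def)
  also have "\<dots> = (+) x ` {(0,1), (0,3), (1,0), (3,0), (1,1), (3,3)}" (is "_ = _ ` ?S")
  proof (intro equalityI subsetI)
    fix y assume "y \<in> {y. y - x \<in> ?S}"
    then show "y \<in> (+) x ` ?S" by (intro image_eqI[where x = "y - x"]) simp_all
  next
    fix y assume "y \<in> (+) x ` ?S"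
    then obtain s where "s \<in> ?S" "y = x + s" by blast
    then show "y \<in> {y. y - x \<in> ?S}" by simp
  qed
  finally show ?thesis .
qed

lemma nbrs_K4: "nbrs K4 x = - {x}"
  by (auto simp: nbrs_def K4_def)

lemma nbrs_cart_prod:
  assumes "u \<in> pverts G" "x \<in> pverts H"
  shows "nbrs (cart_prod G H) (u, x) = (\<lambda>v. (v, x)) ` nbrs G u \<union> Pair u ` nbrs H x"
  using assms by (auto simp: nbrs_def cart_prod_def)

lemma nbrs_cart_power:
  assumes "xs \<in> pverts (cart_power k G)"
  shows "nbrs (cart_power k G) xs = (\<Union>i<k. (\<lambda>v. xs[i := v]) ` nbrs G (xs ! i))"
  using assms by (auto simp: nbrs_def cart_power_def)

lemma nbrs_cart_power_append:
  assumes "xs \<in> pverts (cart_power k G)" "ys \<in> pverts (cart_power k' G)"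
  shows "nbrs (cart_power (k + k') G) (xs @ ys) =
    (\<lambda>zs. zs @ ys) ` nbrs (cart_power k G) xs \<union> (@) xs ` nbrs (cart_power k' G) ys"
proof -
  have len: "length xs = k" "length ys = k'" and
    app: "xs @ ys \<in> pverts (cart_power (k + k') G)"
    using assms by (auto simp: cart_power_def)
  have "{..<k + k'} = {..<k} \<union> (+) k ` {..<k'}"
    by (simp add: lessThan_atLeast0 ivl_disj_un_two(3) add.commute)
  then have "nbrs (cart_power (k + k') G) (xs @ ys) =
      (\<Union>i<k. (\<lambda>v. (xs @ ys)[i := v]) ` nbrs G ((xs @ ys) ! i)) \<union>
      (\<Union>i<k'. (\<lambda>v. (xs @ ys)[k + i := v]) ` nbrs G ((xs @ ys) ! (k + i)))"
    unfolding nbrs_cart_power[OF app] by simp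
  also have "(\<Union>i<k. (\<lambda>v. (xs @ ys)[i := v]) ` nbrs G ((xs @ ys) ! i)) =
      (\<lambda>zs. zs @ ys) ` nbrs (cart_power k G) xs"
    unfolding nbrs_cart_power[OF assms(1)] image_UN image_image
    by (intro SUP_cong refl) (simp add: len list_update_append nth_append)
  also have "(\<Union>i<k'. (\<lambda>v. (xs @ ys)[k + i := v]) ` nbrs G ((xs @ ys) ! (k + i))) =
      (@) xs ` nbrs (cart_power k' G) ys"
    unfolding nbrs_cart_power[OF assms(2)] image_UN image_image
    by (intro SUP_cong refl) (simp add: len list_update_append nth_append)
  finally show ?thesis .
qed

text \<open>Gluing two blocks of factors: this identifies the Cartesian product of D(m,n) and
  D(m',n') with D(m+m',n+n'), and \<open>lpart\<close>, \<open>rpart\<close> recover the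
  blocks.\<close>

definition cat :: "'a list \<times> 'b list \<Rightarrow> 'a list \<times> 'b list \<Rightarrow> 'a list \<times> 'b list" where
  "cat v w = (fst v @ fst w, snd v @ snd w)"

definition lpart :: "nat \<Rightarrow> nat \<Rightarrow> 'a list \<times> 'b list \<Rightarrow> 'a list \<times> 'b list" where
  "lpart m n v = (take m (fst v), take n (snd v))"

definition rpart :: "nat \<Rightarrow> nat \<Rightarrow> 'a list \<times> 'b list \<Rightarrow> 'a list \<times> 'b list" where
  "rpart m n v = (drop m (fst v), drop n (snd v))"

lemma pverts_doob: "pverts (doob_graph m n) = {v. length (fst v) = m \<and> length (snd v) = n}"
  by (auto simp: doob_graph_def cart_prod_def cart_power_def shrikhande_def cayley_graph_def K4_def)

lemma pverts_doob_Pair [simp]: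
  "(xs, ys) \<in> pverts (doob_graph m n) \<longleftrightarrow> length xs = m \<and> length ys = n"
  by (simp add: pverts_doob)

lemma lpart_cat [simp]: "v \<in> pverts (doob_graph m n) \<Longrightarrow> lpart m n (cat v w) = v"
  and rpart_cat [simp]: "v \<in> pverts (doob_graph m n) \<Longrightarrow> rpart m n (cat v w) = w"
  by (auto simp: pverts_doob lpart_def rpart_def cat_def)

lemma cat_in_doob [simp]:
  "v \<in> pverts (doob_graph m n) \<Longrightarrow> w \<in> pverts (doob_graph m' n') \<Longrightarrow>
    cat v w \<in> pverts (doob_graph (m + m') (n + n'))"
  by (simp add: pverts_doob cat_def)

lemma doob_catE:
  assumes "v \<in> pverts (doob_graph (m + m') (n + n'))"
  obtains v1 v2 where "v1 \<in> pverts (doob_graph m n)" "v2 \<in> pverts (doob_graph m' n')"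
    "v = cat v1 v2"
  using assms by (intro that[of "lpart m n v" "rpart m n v"])
    (auto simp: pverts_doob lpart_def rpart_def cat_def)

lemma nbrs_doob_in: "w \<in> nbrs (doob_graph m n) v \<Longrightarrow> w \<in> pverts (doob_graph m n)"
  using pair_graphD(2)[OF pair_graph_doob_graph] by (auto simp: nbrs_def)

lemma nbrs_doob_irrefl: "v \<notin> nbrs (doob_graph m n) v"
  unfolding nbrs_def mem_Collect_eq
  using pair_graphD(3)[OF pair_graph_doob_graph, where u = v and v = v] by blast

lemma nbrs_doob_cat:
  assumes "v \<in> pverts (doob_graph m n)" "w \<in> pverts (doob_graph m' n')"
  shows "nbrs (doob_graph (m + m') (n + n')) (cat v w) =
    (\<lambda>u. cat u w) ` nbrs (doob_graph m n) v \<union> cat v ` nbrs (doob_graph m' n') w"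
proof -
  obtain xs ys xs' ys' where vw: "v = (xs, ys)" "w = (xs', ys')" by fastforce
  have V: "xs \<in> pverts (cart_power m shrikhande)" "ys \<in> pverts (cart_power n K4)"
    "xs' \<in> pverts (cart_power m' shrikhande)" "ys' \<in> pverts (cart_power n' K4)"
    "xs @ xs' \<in> pverts (cart_power (m + m') shrikhande)"
    "ys @ ys' \<in> pverts (cart_power (n + n') K4)"
    using assms by (auto simp: vw doob_graph_def cart_prod_def cart_power_def)
  show ?thesis
    unfolding vw cat_def fst_conv snd_conv doob_graph_def nbrs_cart_prod[OF V(1,2)]
      nbrs_cart_prod[OF V(3,4)] nbrs_cart_prod[OF V(5,6)]
      nbrs_cart_power_append[OF V(1,3)] nbrs_cart_power_append[OF V(2,4)]
    by (simp add: image_Un image_image Un_ac)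
qed

text \<open>Each neighbour of \<open>cat v w\<close> changes exactly one of the two blocks, so
  bijectivity can be checked block by block, provided that the images are disjoint.\<close>

lemma bij_betw_nbrs_cat:
  assumes v: "v \<in> pverts (doob_graph m n)" and w: "w \<in> pverts (doob_graph m' n')"
    and "bij_betw (\<lambda>u. F (cat u w)) (nbrs (doob_graph m n) v) A"
    and "bij_betw (\<lambda>u. F (cat v u)) (nbrs (doob_graph m' n') w) B"
    and "A \<inter> B = {}"
  shows "bij_betw F (nbrs (doob_graph (m + m') (n + n')) (cat v w)) (A \<union> B)"
proof -
  \<comment> \<open>Equal values of \<open>F\<close> on the image come from the same point of
    \<open>N\<close>, hence from the same point of the image.\<close>
  have *: "bij_betw F (g ` N) C" if "bij_betw (\<lambda>u. F (g u)) N C"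
    for g :: "(4 \<times> 4) list \<times> 4 list \<Rightarrow> _" and N C
    using that by (auto simp: bij_betw_def inj_on_def image_image)
  show ?thesis
    unfolding nbrs_doob_cat[OF v w] using *[OF assms(3)] *[OF assms(4)] assms(5)
    by (rule bij_betw_combine)
qed

lemma nbrs_doob_1_0: "nbrs (doob_graph 1 0) ([x], []) = (\<lambda>y. ([y], [])) ` nbrs shrikhande x"
proof -
  have V: "[x] \<in> pverts (cart_power 1 shrikhande)" "[] \<in> pverts (cart_power 0 K4)"
    by (auto simp: cart_power_def shrikhande_def cayley_graph_def)
  show ?thesis
    unfolding doob_graph_def nbrs_cart_prod[OF V] nbrs_cart_power[OF V(1)] nbrs_cart_power[OF V(2)]
    by (simp add: image_image lessThan_Suc)
qed

lemma nbrs_doob_0_1: "nbrs (doob_graph 0 1) ([], [x]) = (\<lambda>y. ([], [y])) ` (- {x})"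
proof -
  have V: "[] \<in> pverts (cart_power 0 shrikhande)" "[x] \<in> pverts (cart_power 1 K4)"
    by (auto simp: cart_power_def K4_def)
  show ?thesis
    unfolding doob_graph_def nbrs_cart_prod[OF V] nbrs_cart_power[OF V(1)] nbrs_cart_power[OF V(2)]
    by (simp add: image_image lessThan_Suc nbrs_K4)
qed

lemma nbrs_doob_0_0: "nbrs (doob_graph 0 0) v = {}"
  by (auto simp: nbrs_def doob_graph_def cart_prod_def cart_power_def)

subsection \<open>Maps with constant difference sets\<close>

text \<open>In other words, \<open>f\<close> is a locally bijective homomorphism into the Cayley
  graph with connection set \<open>D\<close>.\<close>

definition diff_map :: "nat \<Rightarrow> nat \<Rightarrow> ((4 \<times> 4) list \<times> 4 list \<Rightarrow> 'g::ab_group_add) \<Rightarrow> 'g set \<Rightarrow> bool"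
  where "diff_map m n f D \<longleftrightarrow> (\<forall>v \<in> pverts (doob_graph m n).
    bij_betw f (nbrs (doob_graph m n) v) ((+) (f v) ` D))"

text \<open>Moving in one block changes one summand while the other acts as a translation;
  disjointness of \<open>D\<close> and \<open>E\<close> separates the two kinds of
  neighbours.\<close>

lemma diff_map_add:
  assumes f: "diff_map m n f D" and g: "diff_map m' n' g E" and "D \<inter> E = {}"
  shows "diff_map (m + m') (n + n') (\<lambda>v. f (lpart m n v) + g (rpart m n v)) (D \<union> E)"
  unfolding diff_map_def
proof
  let ?F = "\<lambda>v. f (lpart m n v) + g (rpart m n v)"
  fix v assume "v \<in> pverts (doob_graph (m + m') (n + n'))"
  then obtain x y where x: "x \<in> pverts (doob_graph m n)" and y: "y \<in> pverts (doob_graph m' n')"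
    and v: "v = cat x y" by (rule doob_catE)
  have "bij_betw (\<lambda>u. ?F (cat u y)) (nbrs (doob_graph m n) x) ((+) (f x + g y) ` D)"
  proof -
    have "bij_betw f (nbrs (doob_graph m n) x) ((+) (f x) ` D)"
      using f x by (simp add: diff_map_def)
    moreover have "bij_betw (\<lambda>t. t + g y) ((+) (f x) ` D) ((+) (f x + g y) ` D)"
      by (simp add: bij_betw_def inj_on_def image_image ac_simps)
    ultimately have "bij_betw ((\<lambda>t. t + g y) \<circ> f) (nbrs (doob_graph m n) x) ((+) (f x + g y) ` D)"
      by (rule bij_betw_trans)
    moreover have "?F (cat u y) = ((\<lambda>t. t + g y) \<circ> f) u" if "u \<in> nbrs (doob_graph m n) x" for u
      using that by (simp add: nbrs_doob_in)
    ultimately show ?thesis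
      by (simp cong: bij_betw_cong)
  qed
  moreover have "bij_betw (\<lambda>u. ?F (cat x u)) (nbrs (doob_graph m' n') y) ((+) (f x + g y) ` E)"
  proof -
    have "bij_betw g (nbrs (doob_graph m' n') y) ((+) (g y) ` E)"
      using g y by (simp add: diff_map_def)
    moreover have "bij_betw ((+) (f x)) ((+) (g y) ` E) ((+) (f x + g y) ` E)"
      by (simp add: bij_betw_def inj_on_def image_image ac_simps)
    ultimately have "bij_betw ((+) (f x) \<circ> g) (nbrs (doob_graph m' n') y) ((+) (f x + g y) ` E)"
      by (rule bij_betw_trans)
    then show ?thesis
      by (simp add: comp_def x)
  qed
  moreover have "(+) (f x + g y) ` D \<inter> (+) (f x + g y) ` E = {}"
    using \<open>D \<inter> E = {}\<close> by auto
  ultimately show "bij_betw ?F (nbrs (doob_graph (m + m') (n + n')) v) ((+) (?F v) ` (D \<union> E))"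
    using bij_betw_nbrs_cat[OF x y, of ?F] by (simp add: v x y image_Un)
qed

text \<open>Additivity sends the neighbour \<open>x + s\<close> to
  \<open>\<phi> x + \<phi> s\<close>, and injectivity on the connection set keeps the six
  differences apart.\<close>

lemma diff_map_shrikhande:
  fixes \<phi> :: "4 \<times> 4 \<Rightarrow> 'g::ab_group_add"
  assumes add: "\<And>x y. \<phi> (x + y) = \<phi> x + \<phi> y"
    and inj: "inj_on \<phi> {(0,1), (0,3), (1,0), (3,0), (1,1), (3,3)}" (is "inj_on \<phi> ?S")
  shows "diff_map 1 0 (\<lambda>v. \<phi> (hd (fst v))) (\<phi> ` {(0,1), (0,3), (1,0), (3,0), (1,1), (3,3)})"
  unfolding diff_map_def
proof
  fix v :: "(4 \<times> 4) list \<times> 4 list" assume "v \<in> pverts (doob_graph 1 0)"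
  then obtain x where v: "v = ([x], [])"
    by (cases v) (auto simp: length_Suc_conv)
  have "nbrs (doob_graph 1 0) v = (\<lambda>s. ([x + s], [])) ` ?S"
    unfolding v nbrs_doob_1_0 nbrs_shrikhande image_image ..
  moreover have "inj_on (\<lambda>w. \<phi> (hd (fst w))) ((\<lambda>s. ([x + s], [])) ` ?S)"
    by (rule inj_on_imageI) (use inj in \<open>simp add: inj_on_def add\<close>)
  moreover have "(\<lambda>w. \<phi> (hd (fst w))) ` (\<lambda>s. ([x + s], [])) ` ?S = (+) (\<phi> (hd (fst v))) ` \<phi> ` ?S"
    unfolding image_image by (simp only: fst_conv list.sel add v)
  ultimately show "bij_betw (\<lambda>v. \<phi> (hd (fst v))) (nbrs (doob_graph 1 0) v)
      ((+) (\<phi> (hd (fst v))) ` \<phi> ` ?S)"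
    unfolding bij_betw_def by simp
qed

text \<open>\<open>K4\<close> is the Cayley graph of any group of order 4 with all nonzero elements
  as connection set. The labelling \<open>e\<close> chooses the group, so both Z_4 and Z_2^2 are
  available.\<close>

lemma diff_map_K4:
  fixes e :: "4 \<Rightarrow> 'h::ab_group_add" and \<phi> :: "'h \<Rightarrow> 'g::ab_group_add"
  assumes e: "bij e" and add: "\<And>x y. \<phi> (x + y) = \<phi> x + \<phi> y" and inj: "inj \<phi>"
  shows "diff_map 0 1 (\<lambda>v. \<phi> (e (hd (snd v)))) (\<phi> ` (- {0}))"
  unfolding diff_map_def
proof
  fix v :: "(4 \<times> 4) list \<times> 4 list" assume "v \<in> pverts (doob_graph 0 1)"
  then obtain x where v: "v = ([], [x])"
    by (cases v) (auto simp: length_Suc_conv)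
  have shift: "- {e x} = (+) (e x) ` (- {0})"
  proof (intro equalityI subsetI)
    fix y assume "y \<in> - {e x}"
    then show "y \<in> (+) (e x) ` (- {0})" by (intro image_eqI[where x = "y - e x"]) simp_all
  qed auto
  have "(\<lambda>w. \<phi> (e (hd (snd w)))) ` nbrs (doob_graph 0 1) v = \<phi> ` (e ` (- {x}))"
    unfolding v nbrs_doob_0_1 image_image by simp
  also have "e ` (- {x}) = - {e x}"
    using bij_image_Compl_eq[OF e, of "{x}"] by simp
  also have "\<phi> ` (- {e x}) = (+) (\<phi> (e (hd (snd v)))) ` \<phi> ` (- {0})"
    unfolding shift image_image by (simp add: add v)
  finally show "bij_betw (\<lambda>v. \<phi> (e (hd (snd v)))) (nbrs (doob_graph 0 1) v)
      ((+) (\<phi> (e (hd (snd v)))) ` \<phi> ` (- {0}))"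
    using e inj unfolding bij_betw_def v nbrs_doob_0_1
    by (auto simp: inj_on_def)
qed

section \<open>Explicit partitions for the three chunks\<close>

lemma UNIV_Z4: "(UNIV :: 4 set) = {0, 1, 2, 3}"
  using UNIV_4 by auto

lemma UNIV_Z2: "(UNIV :: 2 set) = {0, 1}"
  using UNIV_2 by auto

lemma Z4_numerals: "(5 :: 4) = 1" "(6 :: 4) = 2" "(9 :: 4) = 1" "(15 :: 4) = 3"
  by simp_all

lemma all_Z4: "(\<forall>x::4. P x) \<longleftrightarrow> P 0 \<and> P 1 \<and> P 2 \<and> P 3"
  unfolding ball_UNIV[symmetric] UNIV_Z4 by simp

lemma all_Z2: "(\<forall>x::2. P x) \<longleftrightarrow> P 0 \<and> P 1"
  unfolding ball_UNIV[symmetric] UNIV_Z2 by simp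

lemma diff_map_doob_2_0: "\<exists>f. diff_map 2 0 f (- {(0,0), (0,2), (2,0), (2,2) :: 4 \<times> 4})"
proof -
  \<comment> \<open>An automorphism, of determinant 1. Each of the three nontrivial cosets of the
    subgroup of doubles consists of two pairs of opposite elements; \<open>?S\<close> contains one
    pair and its image under \<open>\<phi>\<close> the other.\<close>
  define \<phi> :: "4 \<times> 4 \<Rightarrow> 4 \<times> 4" where "\<phi> = (\<lambda>(i, j). (2 * i + 3 * j, i + 2 * j))"
  let ?S = "{(0,1), (0,3), (1,0), (3,0), (1,1), (3,3)} :: (4 \<times> 4) set"
  have im: "\<phi> ` ?S = {(3,2), (1,2), (2,1), (2,3), (1,3), (3,1)}"
    by (simp add: \<phi>_def Z4_numerals)
  have 1: "diff_map 1 0 (\<lambda>v. hd (fst v)) ((\<lambda>x. x) ` ?S)"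
    by (rule diff_map_shrikhande) simp_all
  have 2: "diff_map 1 0 (\<lambda>v. \<phi> (hd (fst v))) (\<phi> ` ?S)"
    by (rule diff_map_shrikhande) (auto simp: \<phi>_def algebra_simps)
  have disj: "(\<lambda>x. x) ` ?S \<inter> \<phi> ` ?S = {}"
    unfolding im by simp
  have un: "(\<lambda>x. x) ` ?S \<union> \<phi> ` ?S = - {(0,0), (0,2), (2,0), (2,2)}"
    unfolding im set_eq_iff split_paired_All all_Z4 by simp
  from diff_map_add[OF 1 2 disj, unfolded un one_add_one add_0] show ?thesis
    by - (rule exI)
qed

lemma diff_map_doob_1_2: "\<exists>f. diff_map 1 2 f (- ({0} \<times> UNIV) :: (4 \<times> 4) set)"
proof -
  \<comment> \<open>The coordinate sum \<open>i + j\<close> takes each nonzero value exactly twice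
    on the connection set. The two elements missing over each value are supplied by the lines
    \<open>(y, - y)\<close> and \<open>(y, 2 * y)\<close>, one for each \<open>K4\<close>.\<close>
  define \<phi> :: "4 \<times> 4 \<Rightarrow> 4 \<times> 4" where "\<phi> = (\<lambda>(i, j). (i + j, i))"
  let ?S = "{(0,1), (0,3), (1,0), (3,0), (1,1), (3,3)} :: (4 \<times> 4) set"
  have nz: "- {0} = {1, 2, 3 :: 4}"
    using UNIV_Z4 by auto
  have 1: "diff_map 1 0 (\<lambda>v. \<phi> (hd (fst v))) (\<phi> ` ?S)"
    by (rule diff_map_shrikhande) (auto simp: \<phi>_def algebra_simps)
  have 2: "diff_map 0 1 (\<lambda>v. (\<lambda>y. (y, - y)) (id (hd (snd v)))) ((\<lambda>y. (y, - y)) ` (- {0 :: 4}))"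
    by (rule diff_map_K4[OF bij_id]) (auto simp: inj_on_def)
  have 3: "diff_map 0 1 (\<lambda>v. (\<lambda>y. (y, 2 * y)) (id (hd (snd v)))) ((\<lambda>y. (y, 2 * y)) ` (- {0 :: 4}))"
    by (rule diff_map_K4[OF bij_id]) (auto simp: inj_on_def algebra_simps)
  let ?A = "\<phi> ` ?S" and ?B = "(\<lambda>y. (y, - y)) ` (- {0 :: 4})" and ?C = "(\<lambda>y. (y, 2 * y)) ` (- {0 :: 4})"
  have im: "?A = {(1,0), (3,0), (1,1), (3,3), (2,1), (2,3)}" "?B = {(1,3), (2,2), (3,1)}"
      "?C = {(1,2), (2,0), (3,2)}"
    unfolding nz set_eq_iff split_paired_All all_Z4 by (simp_all add: \<phi>_def)
  have disj: "?A \<inter> ?B = {}" "(?A \<union> ?B) \<inter> ?C = {}"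
    unfolding im by simp_all
  have un: "?A \<union> ?B \<union> ?C = - ({0} \<times> UNIV)"
    unfolding im set_eq_iff split_paired_All all_Z4 by simp
  from diff_map_add[OF diff_map_add[OF 1 2 disj(1)] 3 disj(2),
      unfolded un add_0 add_0_right one_add_one] show ?thesis
    by - (rule exI)
qed

text \<open>In the plane over GF(4), the four nonvertical lines through the origin meet only there
  and cover everything off the vertical line; each \<open>K4\<close> is mapped onto one of
  them.\<close>

lemma diff_map_doob_0_4: "\<exists>f. diff_map 0 4 f (- ({0} \<times> UNIV) :: ((2 \<times> 2) \<times> (2 \<times> 2)) set)"
proof -
  obtain e :: "4 \<Rightarrow> 2 \<times> 2" where e: "bij e"
    using finite_same_card_bij[of "UNIV :: 4 set" "UNIV :: (2 \<times> 2) set"] by auto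
  \<comment> \<open>With \<open>(p, q)\<close> read as \<open>p + q \<omega>\<close> in \<open>GF(4)\<close>, this is \<open>x \<mapsto> (x, c x)\<close> for \<open>c = (a, b)\<close>.\<close>
  define \<phi> :: "2 \<times> 2 \<Rightarrow> 2 \<times> 2 \<Rightarrow> (2 \<times> 2) \<times> (2 \<times> 2)"
    where "\<phi> = (\<lambda>(a, b) (p, q). ((p, q), (a * p + b * q, a * q + b * p + b * q)))"
  have *: "diff_map 0 1 (\<lambda>v. \<phi> c (e (hd (snd v)))) (\<phi> c ` (- {0}))" for c
    by (rule diff_map_K4[OF e]) (auto simp: \<phi>_def inj_on_def algebra_simps split: prod.splits)
  let ?D = "\<lambda>c. \<phi> c ` (- {0})"
  have nz: "- {0} = {(0,1), (1,0), (1,1) :: 2 \<times> 2}"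
    unfolding set_eq_iff split_paired_All all_Z2 by (simp add: zero_prod_def)
  have im: "?D (0,0) = {((0,1),(0,0)), ((1,0),(0,0)), ((1,1),(0,0))}"
    "?D (1,0) = {((0,1),(0,1)), ((1,0),(1,0)), ((1,1),(1,1))}"
    "?D (0,1) = {((0,1),(1,1)), ((1,0),(0,1)), ((1,1),(1,0))}"
    "?D (1,1) = {((0,1),(1,0)), ((1,0),(1,1)), ((1,1),(0,1))}"
    unfolding nz set_eq_iff split_paired_All all_Z2 by (simp_all add: \<phi>_def)
  have disj: "?D (0,0) \<inter> ?D (1,0) = {}" "(?D (0,0) \<union> ?D (1,0)) \<inter> ?D (0,1) = {}"
    "(?D (0,0) \<union> ?D (1,0) \<union> ?D (0,1)) \<inter> ?D (1,1) = {}"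
    unfolding im by simp_all
  have un: "?D (0,0) \<union> ?D (1,0) \<union> ?D (0,1) \<union> ?D (1,1) = - ({0} \<times> UNIV)"
    unfolding im set_eq_iff split_paired_All all_Z2 by (simp add: zero_prod_def)
  have four: "1 + 1 + 1 + 1 = (4 :: nat)" by simp
  from diff_map_add[OF diff_map_add[OF diff_map_add[OF * * disj(1)] * disj(2)] * disj(3),
      unfolded un four add_0] show ?thesis
    by - (rule exI)
qed

subsection \<open>Maps onto powers of K4 with fibre coordinate\<close>

text \<open>On neighbourhoods \<open>\<alpha>\<close> is four-to-one, and \<open>\<beta>\<close>
  tells the four neighbours with equal \<open>\<alpha>\<close> apart. Powers of \<open>K4\<close>
  are written as \<open>doob_graph 0 k\<close> so that \<open>cat\<close> applies to the target
  too.\<close>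

definition fibre_map :: "nat \<Rightarrow> nat \<Rightarrow> nat \<Rightarrow> ((4 \<times> 4) list \<times> 4 list \<Rightarrow> (4 \<times> 4) list \<times> 4 list)
    \<Rightarrow> ((4 \<times> 4) list \<times> 4 list \<Rightarrow> 4) \<Rightarrow> bool" where
  "fibre_map k m n \<alpha> \<beta> \<longleftrightarrow> (\<forall>v \<in> pverts (doob_graph m n). \<alpha> v \<in> pverts (doob_graph 0 k) \<and>
    bij_betw (\<lambda>w. (\<alpha> w, \<beta> w)) (nbrs (doob_graph m n) v) (nbrs (doob_graph 0 k) (\<alpha> v) \<times> UNIV))"

text \<open>The first component of \<open>\<theta>\<close> names the coset of \<open>P\<close>, the
  second the position in it. Neighbours of \<open>v\<close> take each value outside the coset of
  \<open>f v\<close> once, hence every position in every other coset.\<close>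

lemma fibre_map_of_diff_map:
  fixes \<theta> :: "'g::ab_group_add \<Rightarrow> 4 \<times> 4"
  assumes f: "diff_map m n f (- P)" and \<theta>: "bij \<theta>"
    and P: "\<And>s t. fst (\<theta> (s + t)) = fst (\<theta> s) \<longleftrightarrow> t \<in> P"
  shows "fibre_map 1 m n (\<lambda>v. ([], [fst (\<theta> (f v))])) (\<lambda>v. snd (\<theta> (f v)))"
  unfolding fibre_map_def
proof (intro ballI conjI)
  fix v assume v: "v \<in> pverts (doob_graph m n)"
  define h :: "4 \<times> 4 \<Rightarrow> ((4 \<times> 4) list \<times> 4 list) \<times> 4" where "h = (\<lambda>(a, b). (([], [a]), b))"
  let ?N = "nbrs (doob_graph m n) v" and ?B = "(+) (f v) ` (- P)"
  have "?B = \<theta> -` ((- {fst (\<theta> (f v))}) \<times> UNIV)"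
  proof (intro equalityI subsetI)
    fix t assume "t \<in> \<theta> -` ((- {fst (\<theta> (f v))}) \<times> UNIV)"
    then show "t \<in> ?B"
      using P[of "f v" "t - f v"] by (intro image_eqI[where x = "t - f v"]) (auto simp: mem_Times_iff)
  qed (use P in \<open>auto simp: mem_Times_iff\<close>)
  then have im: "\<theta> ` ?B = (- {fst (\<theta> (f v))}) \<times> UNIV"
    using \<theta> by (simp add: bij_is_surj surj_image_vimage_eq)
  have 1: "bij_betw f ?N ?B"
    using f v by (simp add: diff_map_def)
  have 2: "bij_betw \<theta> ?B ((- {fst (\<theta> (f v))}) \<times> UNIV)"
    using \<theta> im by (auto simp: bij_betw_def intro: inj_on_subset)
  have 3: "bij_betw h ((- {fst (\<theta> (f v))}) \<times> UNIV)
      (nbrs (doob_graph 0 1) ([], [fst (\<theta> (f v))]) \<times> UNIV)"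
    unfolding nbrs_doob_0_1 by (auto simp: bij_betw_def inj_on_def h_def image_iff)
  have "h \<circ> (\<theta> \<circ> f) = (\<lambda>w. (([], [fst (\<theta> (f w))]), snd (\<theta> (f w))))"
    by (auto simp: h_def split: prod.split)
  then show "bij_betw (\<lambda>w. (([], [fst (\<theta> (f w))]), snd (\<theta> (f w)))) ?N
      (nbrs (doob_graph 0 1) ([], [fst (\<theta> (f v))]) \<times> UNIV)"
    using bij_betw_trans[OF bij_betw_trans[OF 1 2] 3] by simp
qed simp

section \<open>Fibre maps of the chunks and of their products\<close>

lemma fibre_map_doob_2_0: "\<exists>\<alpha> \<beta>. fibre_map 1 2 0 \<alpha> \<beta>"
proof -
  \<comment> \<open>\<open>2 u + v\<^sup>2\<close> modulo 4 encodes the parities of \<open>u\<close> and \<open>v\<close>.\<close>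
  define \<theta> :: "4 \<times> 4 \<Rightarrow> 4 \<times> 4" where "\<theta> = (\<lambda>(u, v).
    (2 * u + v * v, (if u = 0 \<or> u = 1 then 0 else 2) + (if v = 0 \<or> v = 1 then 0 else 1)))"
  \<comment> \<open>The second component records whether \<open>u\<close> and \<open>v\<close> lie
    in {0,1} or in {2,3}; with the parities this determines both.\<close>
  have "\<forall>x y. \<theta> x = \<theta> y \<longrightarrow> x = y"
    unfolding split_paired_All all_Z4 by (simp add: \<theta>_def)
  then have \<theta>: "bij \<theta>"
    by (simp add: bij_def inj_on_def finite_UNIV_inj_surj)
  have P: "\<forall>s t. fst (\<theta> (s + t)) = fst (\<theta> s) \<longleftrightarrow> t \<in> {(0,0), (0,2), (2,0), (2,2)}"
    unfolding split_paired_All all_Z4 by (simp add: \<theta>_def)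
  obtain f where "diff_map 2 0 f (- {(0,0), (0,2), (2,0), (2,2) :: 4 \<times> 4})"
    using diff_map_doob_2_0 ..
  from fibre_map_of_diff_map[OF this \<theta> P[rule_format]] show ?thesis by - (rule exI, rule exI)
qed

lemma fibre_map_doob_1_2: "\<exists>\<alpha> \<beta>. fibre_map 1 1 2 \<alpha> \<beta>"
proof -
  obtain f where "diff_map 1 2 f (- ({0} \<times> UNIV) :: (4 \<times> 4) set)"
    using diff_map_doob_1_2 by blast
  then have "fibre_map 1 1 2 (\<lambda>v. ([], [fst (id (f v))])) (\<lambda>v. snd (id (f v)))"
    by (rule fibre_map_of_diff_map[OF _ bij_id]) (auto simp: mem_Times_iff)
  then show ?thesis by blast
qed

lemma fibre_map_doob_0_4: "\<exists>\<alpha> \<beta>. fibre_map 1 0 4 \<alpha> \<beta>"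
proof -
  obtain f where f: "diff_map 0 4 f (- ({0} \<times> UNIV) :: ((2 \<times> 2) \<times> (2 \<times> 2)) set)"
    using diff_map_doob_0_4 by blast
  obtain e :: "2 \<times> 2 \<Rightarrow> 4" where e: "bij e"
    using finite_same_card_bij[of "UNIV :: (2 \<times> 2) set" "UNIV :: 4 set"] by auto
  \<comment> \<open>Relabelling each coordinate by an injective map preserves equality of first
    components, which is all that cosets of the vertical line depend on.\<close>
  have "bij (map_prod e e)"
    using bij_betw_map_prod[OF e e] by simp
  from fibre_map_of_diff_map[OF f this] have
    "fibre_map 1 0 4 (\<lambda>v. ([], [fst (map_prod e e (f v))])) (\<lambda>v. snd (map_prod e e (f v)))"
    using e by (simp add: mem_Times_iff bij_is_inj inj_eq)
  then show ?thesis by blast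
qed

lemma bij_betw_map_prod_add:
  fixes c :: "'c::ab_group_add"
  assumes "inj g"
  shows "bij_betw (\<lambda>(a, b). (g a, b + c)) (M \<times> UNIV) (g ` M \<times> UNIV)"
proof -
  have "bij_betw g M (g ` M)"
    using inj_on_subset[OF assms] by (simp add: bij_betw_def)
  then have "bij_betw (map_prod g (\<lambda>b. b + c)) (M \<times> UNIV) (g ` M \<times> UNIV)"
    by (rule bij_betw_map_prod) (rule bij_plus_right)
  then show ?thesis by (simp add: map_prod_def)
qed

text \<open>A move in one block moves that block of the \<open>\<alpha>\<close> value to a
  neighbour; the \<open>\<beta>\<close> value of the other block only shifts the fibre
  coordinate.\<close>

lemma fibre_map_add:
  assumes "fibre_map k m n \<alpha> \<beta>" and "fibre_map k' m' n' \<alpha>' \<beta>'"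
  shows "fibre_map (k + k') (m + m') (n + n')
    (\<lambda>v. cat (\<alpha> (lpart m n v)) (\<alpha>' (rpart m n v))) (\<lambda>v. \<beta> (lpart m n v) + \<beta>' (rpart m n v))"
  unfolding fibre_map_def
proof (intro ballI)
  let ?\<alpha> = "\<lambda>v. cat (\<alpha> (lpart m n v)) (\<alpha>' (rpart m n v))"
  let ?\<beta> = "\<lambda>v. \<beta> (lpart m n v) + \<beta>' (rpart m n v)"
  let ?F = "\<lambda>v. (?\<alpha> v, ?\<beta> v)"
  fix v assume "v \<in> pverts (doob_graph (m + m') (n + n'))"
  then obtain x y where x: "x \<in> pverts (doob_graph m n)" and y: "y \<in> pverts (doob_graph m' n')"
    and v: "v = cat x y" by (rule doob_catE)
  have \<alpha>x: "\<alpha> x \<in> pverts (doob_graph 0 k)" and \<alpha>y: "\<alpha>' y \<in> pverts (doob_graph 0 k')"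
    and bx: "bij_betw (\<lambda>w. (\<alpha> w, \<beta> w)) (nbrs (doob_graph m n) x)
      (nbrs (doob_graph 0 k) (\<alpha> x) \<times> UNIV)"
    and by': "bij_betw (\<lambda>w. (\<alpha>' w, \<beta>' w)) (nbrs (doob_graph m' n') y)
      (nbrs (doob_graph 0 k') (\<alpha>' y) \<times> UNIV)"
    using assms x y by (auto simp: fibre_map_def)
  let ?A = "(\<lambda>u. cat u (\<alpha>' y)) ` nbrs (doob_graph 0 k) (\<alpha> x)"
  let ?B = "cat (\<alpha> x) ` nbrs (doob_graph 0 k') (\<alpha>' y)"
  have "inj (\<lambda>u. cat u (\<alpha>' y))" "inj (cat (\<alpha> x))"
    by (auto simp: inj_on_def cat_def prod_eq_iff)
  have "bij_betw (\<lambda>u. ?F (cat u y)) (nbrs (doob_graph m n) x) (?A \<times> UNIV)"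
  proof -
    have "?F (cat u y) = ((\<lambda>(a, b). (cat a (\<alpha>' y), b + \<beta>' y)) \<circ> (\<lambda>w. (\<alpha> w, \<beta> w))) u"
      if "u \<in> nbrs (doob_graph m n) x" for u
      using that by (simp add: nbrs_doob_in)
    then show ?thesis
      using bij_betw_trans[OF bx bij_betw_map_prod_add[OF \<open>inj (\<lambda>u. cat u (\<alpha>' y))\<close>, of "\<beta>' y"]]
      by (simp cong: bij_betw_cong)
  qed
  moreover have "bij_betw (\<lambda>u. ?F (cat x u)) (nbrs (doob_graph m' n') y) (?B \<times> UNIV)"
    using bij_betw_trans[OF by' bij_betw_map_prod_add[OF \<open>inj (cat (\<alpha> x))\<close>, of "\<beta> x"]]
    by (simp add: x comp_def add.commute)
  moreover have "?A \<inter> ?B = {}"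
  proof -
    \<comment> \<open>A common element would have \<open>\<alpha> x\<close> itself as its left
      block, contradicting that the graph has no loops.\<close>
    have *: "a = \<alpha> x" if "a \<in> nbrs (doob_graph 0 k) (\<alpha> x)" "cat a (\<alpha>' y) = cat (\<alpha> x) b" for a b
      using that lpart_cat[OF \<alpha>x] lpart_cat[OF nbrs_doob_in] by metis
    show ?thesis
    proof (rule equals0I)
      fix t assume "t \<in> ?A \<inter> ?B"
      then obtain a b where "a \<in> nbrs (doob_graph 0 k) (\<alpha> x)" "cat a (\<alpha>' y) = cat (\<alpha> x) b"
        by (elim IntE imageE) simp
      with *[OF this] show False using nbrs_doob_irrefl by simp
    qed
  qed
  then have "(?A \<times> UNIV) \<inter> (?B \<times> (UNIV :: 4 set)) = {}" by auto
  ultimately have "bij_betw ?F (nbrs (doob_graph (m + m') (n + n')) v) (?A \<times> UNIV \<union> ?B \<times> UNIV)"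
    using bij_betw_nbrs_cat[OF x y, of ?F] by (simp add: v)
  moreover have "nbrs (doob_graph 0 (k + k')) (?\<alpha> v) = ?A \<union> ?B"
    using nbrs_doob_cat[OF \<alpha>x \<alpha>y] by (simp add: v x)
  ultimately show "?\<alpha> v \<in> pverts (doob_graph 0 (k + k')) \<and>
      bij_betw ?F (nbrs (doob_graph (m + m') (n + n')) v) (nbrs (doob_graph 0 (k + k')) (?\<alpha> v) \<times> UNIV)"
    using cat_in_doob[OF \<alpha>x \<alpha>y] by (simp add: v x Sigma_Un_distrib1)
qed

text \<open>Counting a Shrikhande factor as 2 and a \<open>K4\<close> as 1, one chunk of weight 4 is
  split off per step.\<close>

lemma fibre_map_exists:
  "2 * m + n = 4 * k \<Longrightarrow> \<exists>\<alpha> \<beta>. fibre_map k m n \<alpha> \<beta>"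
proof (induction k arbitrary: m n)
  case 0
  then have "fibre_map 0 m n (\<lambda>v. ([], [])) (\<lambda>v. 0)"
    by (simp add: fibre_map_def nbrs_doob_0_0 bij_betw_def)
  then show ?case by blast
next
  case (Suc k)
  have step: ?case
    if chunk: "\<exists>\<alpha> \<beta>. fibre_map 1 m' n' \<alpha> \<beta>" and size: "2 * m' + n' = 4" "m' \<le> m" "n' \<le> n" for m' n'
  proof -
    have "2 * (m - m') + (n - n') = 4 * k" using Suc.prems size by simp
    then obtain \<alpha> \<beta> where rest: "fibre_map k (m - m') (n - n') \<alpha> \<beta>" using Suc.IH by blast
    obtain \<alpha>' \<beta>' where "fibre_map 1 m' n' \<alpha>' \<beta>'" using chunk by blast
    from fibre_map_add[OF this rest]
    have "\<exists>\<alpha> \<beta>. fibre_map (1 + k) (m' + (m - m')) (n' + (n - n')) \<alpha> \<beta>"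
      by - (rule exI, rule exI)
    then show ?thesis using size by simp
  qed
  have "m \<ge> 2 \<or> m = 1 \<and> n \<ge> 2 \<or> m = 0 \<and> n \<ge> 4"
    using Suc.prems by arith
  then consider "m \<ge> 2" | "m = 1" "n \<ge> 2" | "m = 0" "n \<ge> 4"
    by blast
  then show ?case
    using step[OF fibre_map_doob_2_0] step[OF fibre_map_doob_1_2] step[OF fibre_map_doob_0_4]
    by cases simp_all
qed

subsection \<open>Rainbow colorings\<close>

text \<open>Lists of length \<open>l\<close> over Z_4 serve as the colors, so that the inductive
  step only has to prepend an entry.\<close>

definition rainbow :: "nat \<Rightarrow> nat \<Rightarrow> nat \<Rightarrow> ((4 \<times> 4) list \<times> 4 list \<Rightarrow> 4 list) \<Rightarrow> bool" where
  "rainbow l m n f \<longleftrightarrow> (\<forall>v \<in> pverts (doob_graph m n). length (f v) = l \<and>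
    bij_betw f (nbrs (doob_graph m n) v) ({c. length c = l} - {f v}))"

lemma rainbow_Suc:
  assumes h: "rainbow l 0 k h" and "fibre_map k m n \<alpha> \<beta>"
  shows "rainbow (Suc l) m (Suc n)
    (\<lambda>v. (\<beta> (lpart m n v) + hd (snd (rpart m n v))) # h (\<alpha> (lpart m n v)))"
  unfolding rainbow_def
proof
  let ?F = "\<lambda>v. (\<beta> (lpart m n v) + hd (snd (rpart m n v))) # h (\<alpha> (lpart m n v))"
  fix v assume "v \<in> pverts (doob_graph m (Suc n))"
  then have "v \<in> pverts (doob_graph (m + 0) (n + 1))" by simp
  then obtain x y' where x: "x \<in> pverts (doob_graph m n)" and y': "y' \<in> pverts (doob_graph 0 1)"
    and "v = cat x y'" by (rule doob_catE)
  then obtain y where y: "y' = ([], [y])" and v: "v = cat x ([], [y])"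
    by (cases y') (auto simp: length_Suc_conv)
  have \<alpha>x: "\<alpha> x \<in> pverts (doob_graph 0 k)"
    and bx: "bij_betw (\<lambda>w. (\<alpha> w, \<beta> w)) (nbrs (doob_graph m n) x)
      (nbrs (doob_graph 0 k) (\<alpha> x) \<times> UNIV)"
    using assms(2) x by (auto simp: fibre_map_def)
  have len: "length (h (\<alpha> x)) = l" and
    bh: "bij_betw h (nbrs (doob_graph 0 k) (\<alpha> x)) ({c. length c = l} - {h (\<alpha> x)})"
    using h \<alpha>x by (auto simp: rainbow_def)
  let ?C = "{c. length c = l} - {h (\<alpha> x)}"
  \<comment> \<open>Moves in the first block reach all colors with a different tail, each once;
    moves in the last \<open>K4\<close> keep the tail and reach all other heads.\<close>
  let ?A = "{b # c | b c. c \<in> ?C}" and ?B = "(\<lambda>b. b # h (\<alpha> x)) ` (- {\<beta> x + y})"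
  have "bij_betw (\<lambda>u. ?F (cat u y')) (nbrs (doob_graph m n) x) ?A"
  proof -
    have "bij (\<lambda>b. b + y)" by (rule bij_plus_right)
    then have "bij_betw (map_prod h (\<lambda>b. b + y)) (nbrs (doob_graph 0 k) (\<alpha> x) \<times> UNIV) (?C \<times> UNIV)"
      by (rule bij_betw_map_prod[OF bh])
    moreover have "bij_betw (\<lambda>(c, b). b # c) (?C \<times> UNIV) ?A"
      by (auto simp: bij_betw_def inj_on_def image_iff)
    ultimately have "bij_betw ((\<lambda>(c, b). b # c) \<circ> (map_prod h (\<lambda>b. b + y) \<circ> (\<lambda>w. (\<alpha> w, \<beta> w))))
        (nbrs (doob_graph m n) x) ?A"
      using bx by (blast intro: bij_betw_trans)
    moreover have "?F (cat u y') = ((\<lambda>(c, b). b # c) \<circ> (map_prod h (\<lambda>b. b + y) \<circ> (\<lambda>w. (\<alpha> w, \<beta> w)))) u"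
      if "u \<in> nbrs (doob_graph m n) x" for u
      using that by (simp add: nbrs_doob_in y)
    ultimately show ?thesis by (simp cong: bij_betw_cong)
  qed
  moreover have "bij_betw (\<lambda>u. ?F (cat x u)) (nbrs (doob_graph 0 1) y') ?B"
  proof -
    have "(\<lambda>w. (\<beta> x + w) # h (\<alpha> x)) ` (- {y}) = (\<lambda>b. b # h (\<alpha> x)) ` (+) (\<beta> x) ` (- {y})"
      by (simp add: image_image)
    also have "(+) (\<beta> x) ` (- {y}) = - {\<beta> x + y}"
      using bij_image_Compl_eq[OF bij_plus, of "\<beta> x" "{y}"] by simp
    finally show ?thesis
      unfolding y nbrs_doob_0_1 bij_betw_def by (simp add: inj_on_def x image_image)
  qed
  moreover have "?A \<inter> ?B = {}" by auto
  ultimately have "bij_betw ?F (nbrs (doob_graph (m + 0) (n + 1)) (cat x y')) (?A \<union> ?B)"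
    by (rule bij_betw_nbrs_cat[OF x y'])
  moreover have "?A \<union> ?B = {c. length c = Suc l} - {?F v}"
    using len by (auto simp: v x length_Suc_conv)
  ultimately show "length (?F v) = Suc l \<and>
      bij_betw ?F (nbrs (doob_graph m (Suc n)) v) ({c. length c = Suc l} - {?F v})"
    using len by (simp add: v y x)
qed

section \<open>Existence of rainbow colorings and merging of colors\<close>

lemma four_power_eq:
  obtains k where "(4 :: nat) ^ l = 3 * k + 1"
proof -
  have "\<exists>k. (4 :: nat) ^ l = 3 * k + 1"
  proof (induction l)
    case (Suc l)
    then obtain k where "(4 :: nat) ^ l = 3 * k + 1" ..
    then have "4 ^ Suc l = 3 * (4 * k + 1) + (1 :: nat)" by simp
    then show ?case ..
  qed (simp add: exI[of _ 0])
  then show thesis using that by blast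
qed

text \<open>The hypothesis equates the size of a closed neighbourhood,
  \<open>6 * m + 3 * n + 1\<close>, with the number of colors.\<close>

lemma rainbow_exists:
  "3 * (2 * m + n) + 1 = 4 ^ l \<Longrightarrow> \<exists>f. rainbow l m n f"
proof (induction l arbitrary: m n)
  case 0
  then have "rainbow 0 m n (\<lambda>v. [])"
    by (auto simp: rainbow_def nbrs_doob_0_0 bij_betw_def)
  then show ?case by blast
next
  case (Suc l)
  obtain k where k: "(4 :: nat) ^ l = 3 * k + 1" by (rule four_power_eq)
  with Suc.prems have eq: "2 * m + n = 4 * k + 1" by simp
  \<comment> \<open>The weight is odd, so there is a \<open>K4\<close> factor to set aside.\<close>
  then obtain n' where n: "n = Suc n'" by (cases n) presburger+
  \<comment> \<open>The induction hypothesis is used for the pure power of \<open>K4\<close> that is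
    the target of the fibre map.\<close>
  obtain h where "rainbow l 0 k h" using Suc.IH[of 0 k] k by auto
  moreover obtain \<alpha> \<beta> where "fibre_map k m n' \<alpha> \<beta>"
    using fibre_map_exists[of m n' k] eq n by auto
  ultimately show ?case unfolding n using rainbow_Suc by blast
qed

theorem theorem3:
  fixes b c l m n :: nat
  assumes "b > 0" and "c > 0" and "l > 0"
    and "gcd b c = 1"
    and "b + c = 4 ^ l"
    and "2 * m + n = (4 ^ l - 1) div 3"
  shows "\<exists>f :: (4 \<times> 4) list \<times> 4 list \<Rightarrow> 2.
    perfect_coloring (doob_graph m n) f (vector [vector [c - 1, b], vector [c, b - 1]])"
proof -
  obtain k where "(4 :: nat) ^ l = 3 * k + 1" by (rule four_power_eq)
  then obtain g where g: "rainbow l m n g"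
    using rainbow_exists[of m n l] assms(6) by auto
  let ?U = "{k :: 4 list. length k = l}"
  have U: "finite ?U" "card ?U = b + c"
    using finite_lists_length_eq[of "UNIV :: 4 set" l] card_lists_length_eq[of "UNIV :: 4 set" l]
      assms(5) by simp_all
  \<comment> \<open>Any \<open>c\<close> rainbow colors are merged into color 1, the other
    \<open>b\<close> into color 2.\<close>
  then obtain C where C: "C \<subseteq> ?U" "card C = c"
    using obtain_subset_with_card_n[of c ?U] by auto
  then have "finite C" using U(1) finite_subset by blast
  have C': "card (?U - C) = b"
    using card_Diff_subset[OF \<open>finite C\<close> C(1)] U(2) C(2) by simp
  define f :: "(4 \<times> 4) list \<times> 4 list \<Rightarrow> 2" where "f v = (if g v \<in> C then 1 else 2)" for v
  \<comment> \<open>Every rainbow color occurs once in the closed neighbourhood, so only the color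
    of \<open>v\<close> itself can be lost from \<open>T\<close>.\<close>
  have count: "card {w \<in> pverts (doob_graph m n). (v, w) \<in> parcs (doob_graph m n) \<and> g w \<in> T} =
      card (T - {g v})"
    if "v \<in> pverts (doob_graph m n)" "T \<subseteq> ?U" for v T
  proof -
    have bij: "bij_betw g (nbrs (doob_graph m n) v) (?U - {g v})"
      using g that(1) by (simp add: rainbow_def)
    let ?W = "{w \<in> nbrs (doob_graph m n) v. g w \<in> T}"
    have in_V: "w \<in> pverts (doob_graph m n)" if "(v, w) \<in> parcs (doob_graph m n)" for w
      by (rule nbrs_doob_in[of _ _ _ v]) (simp add: nbrs_def that)
    have "g ` ?W = g ` nbrs (doob_graph m n) v \<inter> T" by auto
    then have im: "g ` ?W = T - {g v}"
      using bij_betw_imp_surj_on[OF bij] that(2) by auto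
    have inj: "inj_on g ?W"
      using bij_betw_imp_inj_on[OF bij] by (rule inj_on_subset) auto
    have "{w \<in> pverts (doob_graph m n). (v, w) \<in> parcs (doob_graph m n) \<and> g w \<in> T} = ?W"
      unfolding nbrs_def using in_V by blast
    then show ?thesis using card_image[OF inj] im by simp
  qed
  have gU: "g w \<in> ?U" if "w \<in> pverts (doob_graph m n)" for w
    using g that by (simp add: rainbow_def)
  have f1: "card {w \<in> pverts (doob_graph m n). (v, w) \<in> parcs (doob_graph m n) \<and> f w = 1} =
      (if g v \<in> C then c - 1 else c)"
    and f2: "card {w \<in> pverts (doob_graph m n). (v, w) \<in> parcs (doob_graph m n) \<and> f w = 2} =
      (if g v \<in> C then b else b - 1)"
    if v: "v \<in> pverts (doob_graph m n)" for v
  proof -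
    have "{w \<in> pverts (doob_graph m n). (v, w) \<in> parcs (doob_graph m n) \<and> f w = 1} =
        {w \<in> pverts (doob_graph m n). (v, w) \<in> parcs (doob_graph m n) \<and> g w \<in> C}"
      by (auto simp: f_def)
    then show "card {w \<in> pverts (doob_graph m n). (v, w) \<in> parcs (doob_graph m n) \<and> f w = 1} =
        (if g v \<in> C then c - 1 else c)"
      using count[OF v C(1)] C(2) \<open>finite C\<close> by simp
    have "{w \<in> pverts (doob_graph m n). (v, w) \<in> parcs (doob_graph m n) \<and> f w = 2} =
        {w \<in> pverts (doob_graph m n). (v, w) \<in> parcs (doob_graph m n) \<and> g w \<in> ?U - C}"
      using gU by (auto simp: f_def)
    moreover have "card (?U - C - {g v}) = (if g v \<in> C then b else b - 1)"
      using C' gU[OF v] by (simp only: card_Diff_singleton_if) simp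
    ultimately show "card {w \<in> pverts (doob_graph m n). (v, w) \<in> parcs (doob_graph m n) \<and> f w = 2} =
        (if g v \<in> C then b else b - 1)"
      using count[OF v, of "?U - C"] by simp
  qed
  obtain v where v: "v \<in> pverts (doob_graph m n)"
    using that[of "(replicate m 0, replicate n 0)"] by simp
  have fv: "f v = 1 \<longleftrightarrow> g v \<in> C" "f v = 2 \<longleftrightarrow> g v \<notin> C" for v
    by (simp_all add: f_def)
  \<comment> \<open>If \<open>v\<close> does not have color \<open>j\<close>, then it has
    \<open>b\<close> or \<open>c\<close> neighbours of that color, a positive number.\<close>
  have "\<exists>w \<in> pverts (doob_graph m n). f w = j" for j
  proof (cases "f v = j")
    case False
    then have "card {w \<in> pverts (doob_graph m n). (v, w) \<in> parcs (doob_graph m n) \<and> f w = j} \<noteq> 0"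
      using f1[OF v] f2[OF v] assms(1,2) exhaust_2[of j] by (auto simp: fv)
    then have "{w \<in> pverts (doob_graph m n). (v, w) \<in> parcs (doob_graph m n) \<and> f w = j} \<noteq> {}"
      by (metis card.empty)
    then show ?thesis by blast
  qed (use v in blast)
  then have "j \<in> f ` pverts (doob_graph m n)" for j
    by (metis image_eqI)
  then have surj: "f ` pverts (doob_graph m n) = UNIV" by blast
  let ?S = "vector [vector [c - 1, b], vector [c, b - 1]] :: nat^2^2"
  have "card {w \<in> pverts (doob_graph m n). (v, w) \<in> parcs (doob_graph m n) \<and> f w = j} = ?S $ f v $ j"
    if v: "v \<in> pverts (doob_graph m n)" for v j
  proof (cases "g v \<in> C")
    case True
    then have "f v = 1" by (simp add: fv)
    then show ?thesis using f1[OF v] f2[OF v] True exhaust_2[of j] by auto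
  next
    case False
    then have "f v = 2" by (simp add: fv)
    then show ?thesis using f1[OF v] f2[OF v] False exhaust_2[of j] by auto
  qed
  then have "perfect_coloring (doob_graph m n) f ?S"
    unfolding perfect_coloring_def using surj by blast
  then show ?thesis by blast
qed

end
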